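(* Let $n \geq 2$ be an even integer and let $G = \overline{(\frac{n}{2})K_2}$ be the complement of a perfect matching on $n$ vertices. Then $G$ is a circular arc graph and $box(G) = r_{inf}(G) + 1$.
   Context: All graphs are simple, finite and undirected. A circular arc graph is a graph that is the intersection graph of a family of arcs on a circle: each vertex is assigned an arc, and two distinct vertices are adjacent if and only if their arcs intersect. (The whole circle and single points are not considered to be arcs.) For a family $F$ of arcs on a circle and a point $P$ of the circle, the overlap set $\mathcal{O}(P)$ is the set of all arcs of $F$ that contain $P$, and $r_{inf}(F)$ is the minimum of $|\mathcal{O}(P)|$ over all points $P$ of the circle. For a circular arc graph $G$, $r_{inf}(G)$ is the minimum value of $r_{inf}(F)$ over all families of arcs $F$ that represent $G$. A $k$-dimensional box (or $k$-box) is a Cartesian product $R_1 \times \cdots \times R_k$ where each $R_i$ is a closed interval on the real line. The boxicity $box(G)$ of a graph $G$ is the minimum integer $k$ such that $G$ is the intersection graph of a family of $k$-boxes (one box per vertex; two distinct vertices are adjacent if and only if their boxes intersect). *)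

theory Defs
  imports "HOL-Analysis.Analysis" "HOL-Library.Disjoint_Sets" "HOL-Library.FuncSet"
begin

record 'a sgraph =
  verts :: "'a set"
  edges :: "'a set set"

definition simple_graph :: "'a sgraph \<Rightarrow> bool" where
  "simple_graph G \<longleftrightarrow>
     finite (verts G) \<and> edges G \<subseteq> {e. e \<subseteq> verts G \<and> card e = 2}"

definition graph_complement :: "'a sgraph \<Rightarrow> 'a sgraph" where
  "graph_complement G =
     \<lparr>verts = verts G, edges = {e. e \<subseteq> verts G \<and> card e = 2} - edges G\<rparr>"

text \<open>The graph \<open>H\<close> is (a copy of) \<open>m K\<^sub>2\<close>: its \<open>m\<close> edges form a perfect matching
  of its vertex set.\<close>

definition is_copies_of_K2 :: "nat \<Rightarrow> 'a sgraph \<Rightarrow> bool" where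
  "is_copies_of_K2 m H \<longleftrightarrow>
     simple_graph H \<and> card (edges H) = m \<and> disjoint (edges H) \<and> \<Union>(edges H) = verts H"

text \<open>Families are indexed by the vertices, so distinct vertices may receive equal sets.\<close>

definition intersection_model :: "'a sgraph \<Rightarrow> ('a \<Rightarrow> 'b set) \<Rightarrow> bool" where
  "intersection_model G F \<longleftrightarrow>
     (\<forall>u\<in>verts G. \<forall>v\<in>verts G. u \<noteq> v \<longrightarrow> ({u, v} \<in> edges G \<longleftrightarrow> F u \<inter> F v \<noteq> {}))"


text \<open>The circle is the unit circle of the complex plane. Arcs are closed; the strict bounds
  exclude single points and the whole circle.\<close>

definition is_arc :: "complex set \<Rightarrow> bool" where
  "is_arc A \<longleftrightarrow> (\<exists>s t. s < t \<and> t < s + 2 * pi \<and> A = cis ` {s..t})"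

definition arc_representation :: "'a sgraph \<Rightarrow> ('a \<Rightarrow> complex set) \<Rightarrow> bool" where
  "arc_representation G F \<longleftrightarrow> (\<forall>v\<in>verts G. is_arc (F v)) \<and> intersection_model G F"

definition circular_arc_graph :: "'a sgraph \<Rightarrow> bool" where
  "circular_arc_graph G \<longleftrightarrow> simple_graph G \<and> (\<exists>F. arc_representation G F)"

text \<open>The overlap set is given by the indices of the arcs containing \<open>P\<close>, so that its
  cardinality counts equal arcs of different vertices separately.\<close>

definition overlap_set :: "'a set \<Rightarrow> ('a \<Rightarrow> complex set) \<Rightarrow> complex \<Rightarrow> 'a set" where
  "overlap_set V F P = {v \<in> V. P \<in> F v}"

definition r_inf_family :: "'a set \<Rightarrow> ('a \<Rightarrow> complex set) \<Rightarrow> nat" where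
  "r_inf_family V F = (INF P\<in>sphere 0 1. card (overlap_set V F P))"

text \<open>An infimum of a nonempty set of natural numbers is a minimum; the set below is nonempty
  exactly when \<open>G\<close> has an arc representation.\<close>

definition r_inf :: "'a sgraph \<Rightarrow> nat" where
  "r_inf G = Inf {r_inf_family (verts G) F | F. arc_representation G F}"


text \<open>Points of \<open>k\<close>-dimensional space are the functions on \<open>{..<k}\<close> (extended by
  \<open>undefined\<close>), because \<open>k\<close> varies in the definition of boxicity. For \<open>k = 0\<close> the only box is
  a single point, so complete graphs have boxicity 0.\<close>

definition is_box :: "nat \<Rightarrow> (nat \<Rightarrow> real) set \<Rightarrow> bool" where
  "is_box k B \<longleftrightarrow> (\<exists>l u. (\<forall>i<k. l i \<le> u i) \<and> B = (\<Pi>\<^sub>E i\<in>{..<k}. {l i..u i}))"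

definition box_representation :: "nat \<Rightarrow> 'a sgraph \<Rightarrow> ('a \<Rightarrow> (nat \<Rightarrow> real) set) \<Rightarrow> bool" where
  "box_representation k G F \<longleftrightarrow> (\<forall>v\<in>verts G. is_box k (F v)) \<and> intersection_model G F"

definition boxicity :: "'a sgraph \<Rightarrow> nat" where
  "boxicity G = (LEAST k. \<exists>F. box_representation k G F)"

end

theory Submission
  imports Defs
begin

text \<open>Two disjoint pairs of intervals cannot meet crosswise, since the 4-cycle is not an interval
  graph. Hence a coordinate of a box representation separates at most one pair of matched vertices,
  and a point of the circle is missed by both arcs of at most one matched pair (cut the circle
  there). So the boxicity is at least \<open>n/2\<close> and every overlap set has at least \<open>n/2 - 1\<close> elements.
  Giving each pair its own coordinate attains the first bound, and \<open>n\<close> equally spaced arcs slightly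
  shorter than half the circle attain the second.\<close>

section \<open>Intervals and arcs without an induced 4-cycle\<close>

lemma cis_eq_imp_eq:
  assumes "cis a = cis b" "\<bar>a - b\<bar> < 2 * pi"
  shows "a = b"
proof -
  have "sin a = sin b \<and> cos a = cos b"
    using assms(1) by (metis cis.sel)
  then obtain k :: int where k: "a = b + 2 * pi * of_int k"
    using sin_cos_eq_iff[of a b] by auto
  then have "2 * pi * \<bar>real_of_int k\<bar> < 2 * pi * 1"
    using assms(2) by (simp add: abs_mult)
  then have "\<bar>real_of_int k\<bar> < 1" by simp
  then have "k = 0" by linarith
  with k show ?thesis by simp
qed

text \<open>Of two disjoint intervals one lies to the left of the other, and any interval meeting
  both covers the gap between them. So \<open>c\<close> and \<open>d\<close> both cover the gap
  between \<open>a\<close> and \<open>b\<close>, and hence meet each other.\<close>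

lemma no_induced_4_cycle_intervals:
  fixes l u :: "'i \<Rightarrow> real"
  assumes "\<And>i. i \<in> {a, b, c, d} \<Longrightarrow> l i \<le> u i"
    and "{l a..u a} \<inter> {l b..u b} = {}" and "{l c..u c} \<inter> {l d..u d} = {}"
    and "{l a..u a} \<inter> {l c..u c} \<noteq> {}" and "{l a..u a} \<inter> {l d..u d} \<noteq> {}"
    and "{l b..u b} \<inter> {l c..u c} \<noteq> {}" and "{l b..u b} \<inter> {l d..u d} \<noteq> {}"
  shows False
proof -
  have "l a \<le> u a" "l b \<le> u b" "l c \<le> u c" "l d \<le> u d" using assms(1) by auto
  then show False using assms(2-) unfolding Int_atLeastAtMost atLeastatMost_empty_iff
    by (auto simp: max_def min_def split: if_splits)
qed

text \<open>Cutting the circle at \<open>cis p\<close> turns the arc into an interval: its angles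
  miss every copy of \<open>p\<close> modulo \<open>2 * pi\<close>, so they lie between two
  consecutive copies and can be shifted into the window starting at \<open>p\<close>.\<close>

lemma is_arc_avoiding_point:
  assumes "is_arc A" "cis p \<notin> A"
  obtains s t where "p < s" "s \<le> t" "t < p + 2 * pi" "A = cis ` {s..t}"
proof -
  obtain s t where st: "s < t" "t < s + 2 * pi" "A = cis ` {s..t}"
    using assms(1) by (auto simp: is_arc_def)
  \<comment> \<open>Chosen so that \<open>p + c\<close> is the last copy of \<open>p\<close> at or
    before \<open>s\<close>.\<close>
  define k where "k = \<lfloor>(s - p) / (2 * pi)\<rfloor>"
  define c where "c = 2 * pi * of_int k"
  have cisc: "cis (x + c) = cis x" "cis (x - c) = cis x" for x
    by (auto simp: c_def complex_eq_iff sin_diff cos_diff sin_add cos_add)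
  have "of_int k \<le> (s - p) / (2 * pi)" "(s - p) / (2 * pi) < of_int k + 1"
    unfolding k_def by linarith+
  then have c: "c \<le> s - p" "s - p < c + 2 * pi"
    by (auto simp: c_def field_simps)
  \<comment> \<open>Both angles represent \<open>cis p\<close>. Missing the first makes
    \<open>p + c \<le> s\<close> strict; missing the second forces \<open>t\<close> to stay below
    the next copy of \<open>p\<close>.\<close>
  have "p + c \<notin> {s..t}" "p + c + 2 * pi \<notin> {s..t}"
    using assms(2) cisc(1)[of p] st(3) by (metis cis_2pi cis_mult image_eqI mult_1_right)+
  with c st have "p < s - c" "t - c < p + 2 * pi" by auto
  moreover have "A = cis ` {s - c..t - c}"
  proof -
    have "cis ` {s - c..t - c} = cis ` (\<lambda>x. x - c) ` {s..t}" by simp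
    also have "\<dots> = A" unfolding image_image cisc st(3) ..
    finally show ?thesis ..
  qed
  ultimately show ?thesis using that[of "s - c" "t - c"] st(1) by simp
qed

text \<open>Once the circle is cut at a point that all four arcs avoid, the arcs behave like
  intervals of the line, and the interval case applies.\<close>

lemma arcs_avoiding_point_no_4_cycle:
  assumes arcs: "\<And>i. i \<in> {a, b, c, d} \<Longrightarrow> is_arc (F i) \<and> cis p \<notin> F i"
    and "F a \<inter> F b = {}" and "F c \<inter> F d = {}"
    and "F a \<inter> F c \<noteq> {}" and "F a \<inter> F d \<noteq> {}"
    and "F b \<inter> F c \<noteq> {}" and "F b \<inter> F d \<noteq> {}"
  shows False
proof -
  have "\<forall>i. \<exists>s t. i \<in> {a, b, c, d} \<longrightarrow>
      p < s \<and> s \<le> t \<and> t < p + 2 * pi \<and> F i = cis ` {s..t}"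
    using arcs is_arc_avoiding_point by metis
  then obtain s t where st: "\<And>i. i \<in> {a, b, c, d} \<Longrightarrow>
      p < s i \<and> s i \<le> t i \<and> t i < p + 2 * pi \<and> F i = cis ` {s i..t i}"
    by metis
  have inter: "F i \<inter> F j = {} \<longleftrightarrow> {s i..t i} \<inter> {s j..t j} = {}"
    if ij: "i \<in> {a, b, c, d}" "j \<in> {a, b, c, d}" for i j
  proof -
    \<comment> \<open>An image commutes with an intersection when the map is injective on the union;
      \<open>cis\<close> is injective there because both intervals lie in an open window of length
      \<open>2 * pi\<close>.\<close>
    have "F i \<inter> F j = cis ` ({s i..t i} \<inter> {s j..t j})"
    proof -
      have "inj_on cis ({s i..t i} \<union> {s j..t j})"
      proof (rule inj_onI)
        fix x y assume "x \<in> {s i..t i} \<union> {s j..t j}" "y \<in> {s i..t i} \<union> {s j..t j}"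
          and eq: "cis x = cis y"
        then have "p < x" "x < p + 2 * pi" "p < y" "y < p + 2 * pi"
          using st[OF ij(1)] st[OF ij(2)] by auto
        with eq show "x = y" by (intro cis_eq_imp_eq) auto
      qed
      then show ?thesis using st[OF ij(1)] st[OF ij(2)]
        by (metis inj_on_image_Int sup_ge1 sup_ge2)
    qed
    then show ?thesis by simp
  qed
  show False
    by (rule no_induced_4_cycle_intervals[of a b c d s t]) (use st assms(2-) inter in auto)
qed

section \<open>Complements of perfect matchings\<close>

lemma verts_graph_complement [simp]: "verts (graph_complement H) = verts H"
  by (simp add: graph_complement_def)

lemma edges_graph_complement_iff:
  assumes "u \<in> verts H" "v \<in> verts H" "u \<noteq> v"
  shows "{u, v} \<in> edges (graph_complement H) \<longleftrightarrow> {u, v} \<notin> edges H"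
  using assms by (auto simp: graph_complement_def)

lemma simple_graph_complement: "simple_graph H \<Longrightarrow> simple_graph (graph_complement H)"
  by (auto simp: simple_graph_def graph_complement_def)

lemma intersection_model_complement_iff:
  "intersection_model (graph_complement H) F \<longleftrightarrow>
    (\<forall>u\<in>verts H. \<forall>v\<in>verts H. u \<noteq> v \<longrightarrow> ({u, v} \<in> edges H \<longleftrightarrow> F u \<inter> F v = {}))"
  unfolding intersection_model_def by (auto simp: edges_graph_complement_iff)

text \<open>Fixes a first and a second end for all edges at once, so that later proofs can refer to
  them as functions of the edge.\<close>

lemma copies_of_K2_ends:
  assumes "is_copies_of_K2 m H"
  obtains x y where "\<And>e. e \<in> edges H \<Longrightarrow> e = {x e, y e} \<and> x e \<noteq> y e \<and> x e \<in> verts H \<and> y e \<in> verts H"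
proof -
  have "\<forall>e. \<exists>x y. e \<in> edges H \<longrightarrow> e = {x, y} \<and> x \<noteq> y \<and> x \<in> verts H \<and> y \<in> verts H"
    using assms unfolding is_copies_of_K2_def simple_graph_def
    by (auto simp: card_2_iff) blast
  then show ?thesis using that by metis
qed

lemma copies_of_K2_edge_eq:
  assumes "is_copies_of_K2 m H" "e \<in> edges H" "e' \<in> edges H" "v \<in> e" "v \<in> e'"
  shows "e = e'"
  using assms unfolding is_copies_of_K2_def disjoint_def by blast

lemma copies_of_K2_finite_edges:
  assumes "is_copies_of_K2 m H"
  shows "finite (edges H)"
  using assms unfolding is_copies_of_K2_def simple_graph_def
  by (metis finite_UnionD)

text \<open>A matching edge \<open>{a, c}\<close> would share an end with each of the two given
  edges and so equal both. The other three crossings follow by exchanging the ends.\<close>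

lemma copies_of_K2_cross_intersections:
  assumes H: "is_copies_of_K2 m H" and F: "intersection_model (graph_complement H) F"
    and e: "{a, b} \<in> edges H" "{c, d} \<in> edges H" "{a, b} \<noteq> {c, d}"
  shows "F a \<inter> F c \<noteq> {}"
proof -
  have V: "a \<in> verts H" "c \<in> verts H"
    using H e unfolding is_copies_of_K2_def by auto
  have "a \<noteq> c" using copies_of_K2_edge_eq[OF H e(1,2), of a] e(3) by auto
  moreover have "{a, c} \<notin> edges H"
    using copies_of_K2_edge_eq[OF H e(1), of "{a, c}" a]
      copies_of_K2_edge_eq[OF H e(2), of "{a, c}" c] e(3) by auto
  ultimately show ?thesis using F V unfolding intersection_model_complement_iff by blast
qed

lemma copies_of_K2_matched_disjoint:
  assumes H: "is_copies_of_K2 m H" and F: "intersection_model (graph_complement H) F"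
    and "{a, b} \<in> edges H" "a \<noteq> b"
  shows "F a \<inter> F b = {}"
  using assms unfolding is_copies_of_K2_def intersection_model_complement_iff by blast

section \<open>Lower bounds for overlap sets and for boxicity\<close>

text \<open>Two matched pairs whose arcs all avoid \<open>P\<close> would form a forbidden 4-cycle.
  So all edges but at most one have an end in the overlap set, and these ends differ because the
  edges are disjoint.\<close>

lemma copies_of_K2_overlap_ge:
  assumes H: "is_copies_of_K2 m H" and F: "arc_representation (graph_complement H) F"
    and P: "P \<in> sphere 0 1"
  shows "m - 1 \<le> card (overlap_set (verts H) F P)"
proof -
  obtain p where p: "P = cis p" using P by (metis cis_Arg mem_sphere_0 sgn_eq norm_zero one_neq_zero div_by_1 of_real_1)
  have arcs: "\<And>v. v \<in> verts H \<Longrightarrow> is_arc (F v)"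
    and I: "intersection_model (graph_complement H) F"
    using F by (auto simp: arc_representation_def)
  note ed = copies_of_K2_matched_disjoint[OF H I]
  note cr = copies_of_K2_cross_intersections[OF H I]
  define O' where "O' = overlap_set (verts H) F P"
  have fin: "finite (edges H)" using copies_of_K2_finite_edges[OF H] .
  have finO: "finite O'"
    using H unfolding O'_def overlap_set_def is_copies_of_K2_def simple_graph_def by auto
  define M where "M = {e \<in> edges H. e \<inter> O' = {}}"
  obtain x y where xy: "\<And>e. e \<in> edges H \<Longrightarrow>
      e = {x e, y e} \<and> x e \<noteq> y e \<and> x e \<in> verts H \<and> y e \<in> verts H"
    using copies_of_K2_ends[OF H] by (metis (no_types, lifting))
  have "e = e'" if "e \<in> M" "e' \<in> M" for e e'
  proof (rule ccontr)
    assume ne: "e \<noteq> e'"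
    have ee: "e \<in> edges H" "e' \<in> edges H" using that by (auto simp: M_def)
    note X = xy[OF ee(1)] xy[OF ee(2)]
    obtain a b c d where abcd: "x e = a" "y e = b" "x e' = c" "y e' = d" by blast
    have sets: "e = {a, b}" "a \<noteq> b" "e' = {c, d}" "c \<noteq> d" using X abcd by auto
    have V: "{a, b, c, d} \<subseteq> verts H" using X abcd by auto
    have disj: "{a, b, c, d} \<inter> O' = {}" using that sets(1,3) unfolding M_def by blast
    show False
    proof (rule arcs_avoiding_point_no_4_cycle)
      fix v assume v: "v \<in> {a, b, c, d}"
      then have "v \<in> verts H" "v \<notin> O'" using V disj by blast+
      then show "is_arc (F v) \<and> cis p \<notin> F v" using arcs by (simp add: O'_def overlap_set_def p)
    next
      show "F a \<inter> F b = {}" "F c \<inter> F d = {}" using ed ee sets by blast+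
      show "F a \<inter> F c \<noteq> {}" "F a \<inter> F d \<noteq> {}" "F b \<inter> F c \<noteq> {}" "F b \<inter> F d \<noteq> {}"
        using cr[of a b c d] cr[of a b d c] cr[of b a c d] cr[of b a d c] ee ne sets
        by (simp_all add: insert_commute)
    qed
  qed
  moreover have "finite M" using fin by (simp add: M_def)
  ultimately have "card M \<le> 1"
    by (auto simp: card_le_Suc0_iff_eq)
  \<comment> \<open>Each edge outside \<open>M\<close> is charged to one of its ends in
    \<open>O'\<close>; a vertex lies on only one matching edge, so the charging is
    injective.\<close>
  moreover have "card (edges H - M) \<le> card O'"
  proof (rule card_inj_on_le[where f = "\<lambda>e. SOME v. v \<in> e \<inter> O'"])
    have pick: "(SOME v. v \<in> e \<inter> O') \<in> e \<inter> O'" if "e \<in> edges H - M" for e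
      by (rule someI_ex) (use that in \<open>auto simp: M_def\<close>)
    show "inj_on (\<lambda>e. SOME v. v \<in> e \<inter> O') (edges H - M)"
    proof (rule inj_onI)
      fix e e' assume "e \<in> edges H - M" "e' \<in> edges H - M"
        "(SOME v. v \<in> e \<inter> O') = (SOME v. v \<in> e' \<inter> O')"
      then show "e = e'" using pick[of e] pick[of e'] copies_of_K2_edge_eq[OF H] by (metis DiffD1 IntD1)
    qed
    show "(\<lambda>e. SOME v. v \<in> e \<inter> O') ` (edges H - M) \<subseteq> O'" using pick by blast
  qed (rule finO)
  moreover have "card (edges H) = m" using H by (simp add: is_copies_of_K2_def)
  moreover have "card (edges H - M) = card (edges H) - card M"
    by (rule card_Diff_subset) (auto simp: M_def fin)
  ultimately show ?thesis unfolding O'_def by linarith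
qed

text \<open>Disjoint boxes are separated in some coordinate. Choosing one for every matched pair
  gives an injection from the edges into the \<open>k\<close> coordinates, since two pairs separated
  in the same coordinate would form a 4-cycle of intervals.\<close>

lemma copies_of_K2_box_dim_ge:
  assumes H: "is_copies_of_K2 m H" and F: "box_representation k (graph_complement H) F"
  shows "m \<le> k"
proof -
  have I: "intersection_model (graph_complement H) F"
    using F by (auto simp: box_representation_def)
  note ed = copies_of_K2_matched_disjoint[OF H I]
  note cr = copies_of_K2_cross_intersections[OF H I]
  have "\<forall>v. \<exists>l u. v \<in> verts H \<longrightarrow> (\<forall>i<k. l i \<le> u i) \<and> F v = (\<Pi>\<^sub>E i\<in>{..<k}. {l i..u i})"
    using F by (auto simp: box_representation_def is_box_def)
  then obtain l u where lu: "\<And>v. v \<in> verts H \<Longrightarrow>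
      (\<forall>i<k. l v i \<le> u v i) \<and> F v = (\<Pi>\<^sub>E i\<in>{..<k}. {l v i..u v i :: real})"
    by metis
  \<comment> \<open>A product is empty exactly when a factor is. This covers \<open>k = 0\<close>
    too, where no two boxes are disjoint.\<close>
  have int: "F v \<inter> F w = {} \<longleftrightarrow> (\<exists>i<k. {l v i..u v i} \<inter> {l w i..u w i} = {})"
    if "v \<in> verts H" "w \<in> verts H" for v w
  proof -
    have "F v \<inter> F w = (\<Pi>\<^sub>E i\<in>{..<k}. {l v i..u v i} \<inter> {l w i..u w i})"
      using lu that by (simp add: PiE_Int)
    then show ?thesis by (auto simp: PiE_eq_empty_iff)
  qed
  obtain x y where xy: "\<And>e. e \<in> edges H \<Longrightarrow>
      e = {x e, y e} \<and> x e \<noteq> y e \<and> x e \<in> verts H \<and> y e \<in> verts H"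
    using copies_of_K2_ends[OF H] by (metis (no_types, lifting))
  have "\<forall>e\<in>edges H. \<exists>i<k. {l (x e) i..u (x e) i} \<inter> {l (y e) i..u (y e) i} = {}"
  proof
    fix e assume e: "e \<in> edges H"
    then have "F (x e) \<inter> F (y e) = {}" using ed xy[OF e] by metis
    then show "\<exists>i<k. {l (x e) i..u (x e) i} \<inter> {l (y e) i..u (y e) i} = {}"
      using int xy[OF e] by blast
  qed
  then obtain g where g: "\<And>e. e \<in> edges H \<Longrightarrow>
      g e < k \<and> {l (x e) (g e)..u (x e) (g e)} \<inter> {l (y e) (g e)..u (y e) (g e)} = {}"
    by metis
  have "inj_on g (edges H)"
  proof (rule inj_onI, rule ccontr)
    fix e e' assume ee: "e \<in> edges H" "e' \<in> edges H" and eq: "g e = g e'" and ne: "e \<noteq> e'"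
    note X = xy[OF ee(1)] xy[OF ee(2)]
    define i where "i = g e"
    have i: "i < k" using g ee(1) by (simp add: i_def)
    obtain a b c d where abcd: "x e = a" "y e = b" "x e' = c" "y e' = d" by blast
    have sets: "e = {a, b}" "e' = {c, d}" using X abcd by auto
    have V: "a \<in> verts H" "b \<in> verts H" "c \<in> verts H" "d \<in> verts H" using X abcd by auto
    have Fne: "F a \<inter> F c \<noteq> {}" "F a \<inter> F d \<noteq> {}" "F b \<inter> F c \<noteq> {}" "F b \<inter> F d \<noteq> {}"
      using cr[of a b c d] cr[of a b d c] cr[of b a c d] cr[of b a d c] ee ne sets
      by (simp_all add: insert_commute)
    show False
    proof (rule no_induced_4_cycle_intervals[of a b c d "\<lambda>v. l v i" "\<lambda>v. u v i"])
      show "l v i \<le> u v i" if "v \<in> {a, b, c, d}" for v using that lu V i by auto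
      show "{l a i..u a i} \<inter> {l b i..u b i} = {}" "{l c i..u c i} \<inter> {l d i..u d i} = {}"
        using g[OF ee(1)] g[OF ee(2)] eq abcd by (auto simp: i_def)
      show "{l a i..u a i} \<inter> {l c i..u c i} \<noteq> {}" "{l a i..u a i} \<inter> {l d i..u d i} \<noteq> {}"
        "{l b i..u b i} \<inter> {l c i..u c i} \<noteq> {}" "{l b i..u b i} \<inter> {l d i..u d i} \<noteq> {}"
        using Fne i V by (metis int)+
    qed
  qed
  then have "card (edges H) \<le> card {..<k}"
    by (rule card_inj_on_le) (use g in auto)
  then show ?thesis using H by (simp add: is_copies_of_K2_def)
qed

section \<open>Vertex numbering and the box model\<close>

text \<open>With the edges numbered below \<open>m\<close>, one end takes the number of its edge and
  the other end that number plus \<open>m\<close>. Both models use this: a pair owns a coordinate in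
  one, and opposite starting points in the other.\<close>

lemma copies_of_K2_numbering:
  assumes H: "is_copies_of_K2 m H"
  obtains f :: "'a \<Rightarrow> nat" where "inj_on f (verts H)" "\<And>v. v \<in> verts H \<Longrightarrow> f v < 2 * m"
    "\<And>u v. u \<in> verts H \<Longrightarrow> v \<in> verts H \<Longrightarrow> {u, v} \<in> edges H \<longleftrightarrow> f v = f u + m \<or> f u = f v + m"
proof -
  have c: "card (edges H) = m" using H by (simp add: is_copies_of_K2_def)
  obtain h where "bij_betw h (edges H) {0..<m}"
    using ex_bij_betw_finite_nat[OF copies_of_K2_finite_edges[OF H]] c by blast
  then have h: "inj_on h (edges H)" "\<And>e. e \<in> edges H \<Longrightarrow> h e < m"
    by (auto simp: bij_betw_def)
  obtain x y where xy: "\<And>e. e \<in> edges H \<Longrightarrow>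
      e = {x e, y e} \<and> x e \<noteq> y e \<and> x e \<in> verts H \<and> y e \<in> verts H"
    using copies_of_K2_ends[OF H] by (metis (no_types, lifting))
  have "\<forall>v. \<exists>e. v \<in> verts H \<longrightarrow> e \<in> edges H \<and> v \<in> e"
    using H unfolding is_copies_of_K2_def by blast
  then obtain E where E: "\<And>v. v \<in> verts H \<Longrightarrow> E v \<in> edges H \<and> v \<in> E v" by metis
  have Eeq: "E v = e" if "v \<in> verts H" "e \<in> edges H" "v \<in> e" for v e
    using copies_of_K2_edge_eq[OF H] E that by metis
  \<comment> \<open>As \<open>h\<close> stays below \<open>m\<close> on edges, the value determines
    both the edge and which end is meant.\<close>
  define f where "f v = h (E v) + (if v = x (E v) then 0 else m)" for v
  have mates: "{u, v} \<in> edges H \<longleftrightarrow> E u = E v \<and> u \<noteq> v"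
    if "u \<in> verts H" "v \<in> verts H" for u v
  proof
    assume e: "{u, v} \<in> edges H"
    then have "u \<noteq> v" using xy[OF e] by auto
    then show "E u = E v \<and> u \<noteq> v" using Eeq e that by (metis insertCI)
  next
    assume a: "E u = E v \<and> u \<noteq> v"
    have "u \<in> {x (E u), y (E u)}" "v \<in> {x (E u), y (E u)}" "E u = {x (E u), y (E u)}"
      using xy[of "E u"] E[of u] E[of v] a that by metis+
    with a have "E u = {u, v}" by (elim insertE) auto
    then show "{u, v} \<in> edges H" using E that by metis
  qed
  have heq: "h (E u) = h (E v) \<longleftrightarrow> E u = E v" if "u \<in> verts H" "v \<in> verts H" for u v
    using inj_on_eq_iff[OF h(1)] E that by metis
  have two: "u = v" if "u \<in> verts H" "v \<in> verts H" "E u = E v" "(u = x (E u)) = (v = x (E v))" for u v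
  proof -
    have "u \<in> {x (E u), y (E u)}" "v \<in> {x (E u), y (E u)}"
      using xy[of "E u"] E[of u] E[of v] that(1-3) by metis+
    with that(3,4) show ?thesis by (metis insertE singletonD)
  qed
  show ?thesis
  proof
    show "f v < 2 * m" if "v \<in> verts H" for v using h(2)[of "E v"] E[OF that] by (auto simp: f_def)
    show "inj_on f (verts H)"
    proof (rule inj_onI)
      fix u v assume V: "u \<in> verts H" "v \<in> verts H" and eq: "f u = f v"
      show "u = v"
        using two[OF V] heq[OF V] h(2)[of "E u"] h(2)[of "E v"] E[OF V(1)] E[OF V(2)] eq
        by (auto simp: f_def split: if_splits)
    qed
    show "{u, v} \<in> edges H \<longleftrightarrow> f v = f u + m \<or> f u = f v + m"
      if V: "u \<in> verts H" "v \<in> verts H" for u v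
      using two[OF V] mates[OF V] heq[OF V] h(2)[of "E u"] h(2)[of "E v"] E[OF V(1)] E[OF V(2)]
      by (auto simp: f_def split: if_splits)
  qed
qed

lemma copies_of_K2_box_representation:
  assumes H: "is_copies_of_K2 m H"
  shows "\<exists>F. box_representation m (graph_complement H) F"
proof -
  obtain f :: "'a \<Rightarrow> nat" where f: "inj_on f (verts H)" "\<And>v. v \<in> verts H \<Longrightarrow> f v < 2 * m"
    "\<And>u v. u \<in> verts H \<Longrightarrow> v \<in> verts H \<Longrightarrow> {u, v} \<in> edges H \<longleftrightarrow> f v = f u + m \<or> f u = f v + m"
    using copies_of_K2_numbering[OF H] by (metis (no_types, lifting))
  \<comment> \<open>In coordinate \<open>i\<close> the vertex numbered \<open>i\<close> gets
    \<open>[0, 1]\<close>, its mate \<open>[2, 3]\<close>, and every other vertex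
    \<open>[0, 3]\<close>, so only this pair is separated there.\<close>
  define l r :: "'a \<Rightarrow> nat \<Rightarrow> real"
    where "l v i = (if f v = i + m then 2 else 0)" and "r v i = (if f v = i then 1 else 3)" for v i
  define F where "F v = (\<Pi>\<^sub>E i\<in>{..<m}. {l v i..r v i})" for v
  have "l v i \<le> r v i" if "i < m" for v i using that by (auto simp: l_def r_def)
  then have "is_box m (F v)" for v
    unfolding is_box_def F_def by blast
  moreover have "intersection_model (graph_complement H) F"
    unfolding intersection_model_complement_iff
  proof (intro ballI impI)
    fix u v assume V: "u \<in> verts H" "v \<in> verts H" and "u \<noteq> v"
    then have ne: "f u \<noteq> f v" using f(1) by (auto dest: inj_onD)
    have "F u \<inter> F v = (\<Pi>\<^sub>E i\<in>{..<m}. {l u i..r u i} \<inter> {l v i..r v i})"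
      by (simp add: F_def PiE_Int)
    then have "F u \<inter> F v = {} \<longleftrightarrow> (\<exists>i<m. max (l u i) (l v i) > min (r u i) (r v i))"
      by (simp add: PiE_eq_empty_iff Bex_def not_le less_max_iff_disj min_less_iff_disj) blast
    \<comment> \<open>The maximum is 0 or 2 and the minimum 1 or 3, so the inequality means 2
      against 1: one of the two vertices is numbered \<open>i + m\<close> and the other
      \<open>i\<close>.\<close>
    also have "\<dots> \<longleftrightarrow> (\<exists>i<m. f u = i \<and> f v = i + m \<or> f v = i \<and> f u = i + m)"
      using ne by (intro ex_cong1 conj_cong) (auto simp: l_def r_def)
    also have "\<dots> \<longleftrightarrow> f v = f u + m \<or> f u = f v + m" using f(2)[OF V(1)] f(2)[OF V(2)] by auto
    finally show "{u, v} \<in> edges H \<longleftrightarrow> F u \<inter> F v = {}" using f(3)[OF V] by simp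
  qed
  ultimately show ?thesis unfolding box_representation_def by blast
qed

section \<open>The model by arcs slightly shorter than half the circle\<close>

text \<open>Angles are measured in units of \<open>pi / m\<close>, so that the full circle has length \<open>2 * m\<close>.\<close>

definition near_half_arc :: "nat \<Rightarrow> nat \<Rightarrow> complex set" where
  "near_half_arc m j = cis ` {real j * pi / m..(real j + m - 1/2) * pi / m}"

lemma mem_near_half_arc_iff:
  assumes "m > 0"
  shows "z \<in> near_half_arc m j \<longleftrightarrow> (\<exists>a::real. j \<le> a \<and> a \<le> real j + m - 1/2 \<and> z = cis (a * pi / m))"
proof
  assume "z \<in> near_half_arc m j"
  then obtain t where t: "z = cis t" "real j * pi / m \<le> t" "t \<le> (real j + m - 1/2) * pi / m"
    by (auto simp: near_half_arc_def)
  then show "\<exists>a::real. j \<le> a \<and> a \<le> real j + m - 1/2 \<and> z = cis (a * pi / m)"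
    using assms by (intro exI[of _ "t * m / pi"]) (auto simp: field_simps)
next
  assume "\<exists>a::real. j \<le> a \<and> a \<le> real j + m - 1/2 \<and> z = cis (a * pi / m)"
  then obtain a :: real where a: "j \<le> a" "a \<le> real j + m - 1/2" "z = cis (a * pi / m)" by blast
  have "real j * pi / m \<le> a * pi / m" "a * pi / m \<le> (real j + m - 1/2) * pi / m"
    by (intro divide_right_mono mult_right_mono a pi_ge_zero of_nat_0_le_iff)+
  then show "z \<in> near_half_arc m j" unfolding near_half_arc_def a(3)
    by (intro imageI) (simp only: atLeastAtMost_iff)
qed

lemma cis_units_eq_imp_eq:
  assumes "m > 0" "cis (a * pi / real m) = cis (b * pi / real m)" "\<bar>a - b\<bar> < 2 * real m"
  shows "a = b"
proof -
  have "a * pi / m - b * pi / m = (a - b) * (pi / m)"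
    by (simp add: left_diff_distrib diff_divide_distrib)
  then have "\<bar>a * pi / m - b * pi / m\<bar> = \<bar>a - b\<bar> * (pi / m)"
    by (simp add: abs_mult)
  also have "\<dots> < 2 * real m * (pi / m)" using assms by (intro mult_strict_right_mono) auto
  finally have "\<bar>a * pi / m - b * pi / m\<bar> < 2 * pi" using assms(1) by simp
  from cis_eq_imp_eq[OF assms(2) this] show ?thesis using assms(1) by simp
qed

lemma is_arc_near_half_arc:
  assumes "m > 0"
  shows "is_arc (near_half_arc m j)"
proof -
  have "real j * pi / m < (real j + m - 1/2) * pi / m"
    using assms by (intro divide_strict_right_mono mult_strict_right_mono) auto
  moreover have "(real j + m - 1/2) * pi / m < real j * pi / m + 2 * pi"
    using assms by (simp add: field_simps add_pos_pos)
  ultimately show ?thesis unfolding is_arc_def near_half_arc_def by blast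
qed

text \<open>Arc \<open>i\<close> covers the starting points \<open>i\<close> to
  \<open>i + m - 1\<close> and ends half a unit before \<open>i + m\<close>. Two arcs therefore meet
  if one start is fewer than \<open>m\<close> units ahead of the other, which fails in both
  directions only for opposite starts.\<close>

lemma near_half_arc_disjoint_iff:
  assumes m: "m > 0" and ij: "i < j" "j < 2 * m"
  shows "near_half_arc m i \<inter> near_half_arc m j = {} \<longleftrightarrow> j = i + m"
proof
  assume e: "near_half_arc m i \<inter> near_half_arc m j = {}"
  show "j = i + m"
  proof (rule ccontr)
    assume "j \<noteq> i + m"
    then consider "j < i + m" | "j > i + m" by linarith
    then show False
    proof cases
      case 1
      then have "cis (j * pi / m) \<in> near_half_arc m i \<inter> near_half_arc m j"
        using ij m by (auto simp: mem_near_half_arc_iff intro!: exI[of _ "real j"])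
      with e show False by blast
    next
      case 2
      \<comment> \<open>Here arc \<open>j\<close> runs past the angle 0 and reaches the start of arc
        \<open>i\<close> one full turn later, at \<open>i + 2 * m\<close>.\<close>
      have "cis (real (i + 2 * m) * pi / m) = cis (i * pi / m + 2 * pi)"
        using m by (simp add: field_simps)
      also have "\<dots> = cis (i * pi / m)" by (simp flip: cis_mult)
      finally have eq: "cis (real (i + 2 * m) * pi / m) = cis (i * pi / m)" .
      have "cis (i * pi / m) \<in> near_half_arc m i"
        using m by (auto simp: mem_near_half_arc_iff intro!: exI[of _ "real i"])
      moreover have "cis (i * pi / m) \<in> near_half_arc m j"
        unfolding mem_near_half_arc_iff[OF m]
        by (rule exI[of _ "real (i + 2 * m)"]) (use 2 ij eq in auto)
      ultimately show False using e by blast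
    qed
  qed
next
  assume j: "j = i + m"
  show "near_half_arc m i \<inter> near_half_arc m j = {}"
  proof (rule ccontr)
    assume "near_half_arc m i \<inter> near_half_arc m j \<noteq> {}"
    then obtain a b :: real where "i \<le> a" "a \<le> real i + m - 1/2" "j \<le> b" "b \<le> real j + m - 1/2"
      and eq: "cis (a * pi / m) = cis (b * pi / m)"
      unfolding ex_in_conv[symmetric] Int_iff mem_near_half_arc_iff[OF m] by metis
    \<comment> \<open>For opposite starts \<open>b - a\<close> lies between \<open>1/2\<close> and
      \<open>2 * m - 1/2\<close>, strictly within one full turn.\<close>
    then have "\<bar>a - b\<bar> < 2 * real m" "a \<noteq> b" using j by auto
    with cis_units_eq_imp_eq[OF m eq] show False by simp
  qed
qed

text \<open>The point lies a quarter unit before the starting point 0, whereas arc \<open>m\<close>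
  already ends at \<open>2 * m - 1/2\<close> and arcs with smaller numbers end earlier
  still.\<close>

lemma near_half_arc_gap:
  assumes m: "m > 0" and "j < 2 * m" "cis ((2 * real m - 1/4) * pi / m) \<in> near_half_arc m j"
  shows "m < j"
proof -
  obtain a :: real where a: "j \<le> a" "a \<le> real j + m - 1/2"
    and eq: "cis (a * pi / m) = cis ((2 * real m - 1/4) * pi / m)"
    using assms(3) unfolding mem_near_half_arc_iff[OF m] by metis
  \<comment> \<open>Bounds \<open>a\<close> by \<open>3 * m - 3/2\<close>, so that the point cannot
    be reached after an additional full turn.\<close>
  have "real j \<le> 2 * real m - 1" using assms(2) by linarith
  with a have "a = 2 * real m - 1/4" using m by (intro cis_units_eq_imp_eq[OF m eq]) auto
  with a show ?thesis by linarith
qed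

lemma copies_of_K2_arc_representation:
  assumes H: "is_copies_of_K2 m H" and m: "m > 0"
  shows "\<exists>F P. arc_representation (graph_complement H) F \<and> P \<in> sphere 0 1 \<and>
    card (overlap_set (verts H) F P) \<le> m - 1"
proof -
  obtain f :: "'a \<Rightarrow> nat" where f: "inj_on f (verts H)" "\<And>v. v \<in> verts H \<Longrightarrow> f v < 2 * m"
    "\<And>u v. u \<in> verts H \<Longrightarrow> v \<in> verts H \<Longrightarrow> {u, v} \<in> edges H \<longleftrightarrow> f v = f u + m \<or> f u = f v + m"
    using copies_of_K2_numbering[OF H] by (metis (no_types, lifting))
  define F where "F v = near_half_arc m (f v)" for v
  define P where "P = cis ((2 * real m - 1/4) * pi / m)"
  have "intersection_model (graph_complement H) F"
    unfolding intersection_model_complement_iff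
  proof (intro ballI impI)
    fix u v assume V: "u \<in> verts H" "v \<in> verts H" and "u \<noteq> v"
    then have "f u < f v \<or> f v < f u" using f(1) by (metis inj_onD linorder_neqE_nat)
    then show "{u, v} \<in> edges H \<longleftrightarrow> F u \<inter> F v = {}"
      unfolding f(3)[OF V] F_def
      using near_half_arc_disjoint_iff[OF m, of "f u" "f v"]
        near_half_arc_disjoint_iff[OF m, of "f v" "f u"] f(2)[OF V(1)] f(2)[OF V(2)]
      by (auto simp: Int_commute)
  qed
  then have "arc_representation (graph_complement H) F"
    using is_arc_near_half_arc[OF m] by (simp add: arc_representation_def F_def)
  \<comment> \<open>Only the numbers \<open>m + 1\<close> to \<open>2 * m - 1\<close> can occur at
    \<open>P\<close>, which leaves \<open>m - 1\<close> of them.\<close>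
  moreover have "card (overlap_set (verts H) F P) \<le> card {m<..<2 * m}"
  proof (rule card_inj_on_le[where f = f])
    show "inj_on f (overlap_set (verts H) F P)"
      using f(1) by (rule inj_on_subset) (auto simp: overlap_set_def)
    show "f ` overlap_set (verts H) F P \<subseteq> {m<..<2 * m}"
      using near_half_arc_gap[OF m] f(2) by (auto simp: overlap_set_def F_def P_def)
  qed auto
  moreover have "P \<in> sphere 0 1" by (simp add: P_def)
  ultimately show ?thesis by (intro exI[of _ F] exI[of _ P]) auto
qed

theorem mainTheorem4:
  fixes n :: nat and H G :: "'a sgraph"
  assumes "n \<ge> 2" and "even n"
    and "is_copies_of_K2 (n div 2) H"
    and "G = graph_complement H"
  shows "circular_arc_graph G \<and> boxicity G = r_inf G + 1"
proof -
  define m where "m = n div 2"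
  have m: "m > 0" using assms(1) by (simp add: m_def)
  have H: "is_copies_of_K2 m H" using assms(3) by (simp add: m_def)
  obtain F P where F: "arc_representation G F" and P: "P \<in> sphere 0 1"
    and le: "card (overlap_set (verts G) F P) \<le> m - 1"
    using copies_of_K2_arc_representation[OF H m] by (auto simp: assms(4))
  have "circular_arc_graph G"
    using F simple_graph_complement[of H] H
    by (auto simp: circular_arc_graph_def assms(4) is_copies_of_K2_def)
  moreover have "boxicity G = m"
    unfolding boxicity_def assms(4)
    using copies_of_K2_box_representation[OF H] copies_of_K2_box_dim_ge[OF H]
    by (intro Least_equality) auto
  moreover have "r_inf G = m - 1"
  proof (rule antisym)
    have "r_inf G \<le> r_inf_family (verts G) F"
      unfolding r_inf_def using F by (intro cInf_lower) auto
    also have "\<dots> \<le> card (overlap_set (verts G) F P)"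
      unfolding r_inf_family_def using P by (intro cINF_lower) auto
    finally show "r_inf G \<le> m - 1" using le by simp
    show "m - 1 \<le> r_inf G"
      unfolding r_inf_def
    proof (rule cInf_greatest)
      fix r assume "r \<in> {r_inf_family (verts G) F |F. arc_representation G F}"
      then obtain F' where "r = r_inf_family (verts G) F'" "arc_representation G F'" by blast
      then show "m - 1 \<le> r"
        \<comment> \<open>\<open>P\<close> also shows that the circle is nonempty, as a greatest
          lower bound over it requires.\<close>
        using copies_of_K2_overlap_ge[OF H] P unfolding r_inf_family_def assms(4)
        by (auto intro!: cINF_greatest simp del: mem_sphere_0)
    \<comment> \<open>The explicit model makes the set of values nonempty, so its infimum is a true
      minimum.\<close>
    qed (use F in auto)
  qed
  \<comment> \<open>Subtraction on \<open>nat\<close> is truncated; \<open>m > 0\<close> gives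
    \<open>m - 1 + 1 = m\<close>.\<close>
  ultimately show ?thesis using m by simp
qed

end
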